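(* Let $F(z)=D+C(zI-A)^{-1}B$ with realization $\Sigma=(A,B,C,D)$. Consider a maximal solution $(\Pi'_{\max},H'_{\max},\Lambda'_{\max})$ of the equation $$[\Pi'_{\max},\,H'_{\max}]\begin{bmatrix}A&B\\C&D\end{bmatrix}=[\Lambda'_{\max}\Pi'_{\max},\,0].$$ Then $\ker\Pi'_{\max}=\mathcal C^*(\Sigma)$; in other words $\bigl(\mathcal V^*_{\rm left}(\Sigma)\bigr)^\perp=\mathcal C^*(\Sigma)$.
   Context: $A\in\mathbb C^{n\times n}$, $B\in\mathbb C^{n\times q}$, $C\in\mathbb C^{p\times n}$, $D\in\mathbb C^{p\times q}$. A solution of the equation is maximal if the row space of $\Pi'_{\max}$ contains the row space of $\Pi'$ for every other solution $(\Pi',H',\Lambda')$; this maximal row space is $\mathcal V^*_{\rm left}(\Sigma)$, the maximal output-nulling controlled invariant subspace defined with respect to left multiplication $g\mapsto gF$. For a subspace $\mathcal S$ of row vectors, $\mathcal S^\perp=\{x\in\mathbb C^n: sx=0\ \text{for all } s\in\mathcal S\}$. $\mathcal C^*(\Sigma)$ is the set of $x\in\mathbb C^n$ for which there are $k\ge0$ and inputs $u(-k),\dots,u(0)$ such that the system $x(j+1)=Ax(j)+Bu(j)$, $y(j)=Cx(j)+Du(j)$ started at $x(-k)=0$ satisfies $y(j)=0$ for $-k\le j\le0$ and $x(1)=x$. *)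

theory Defs
  imports "Jordan_Normal_Form.VS_Connect" "Jordan_Normal_Form.Matrix_Kernel"
begin

text \<open>Matrices have explicit dimensions (\<^typ>\<open>complex mat\<close> with \<^const>\<open>carrier_mat\<close>), since solutions
  with different numbers of rows have to be compared.\<close>

definition row_block :: "complex mat \<Rightarrow> complex mat \<Rightarrow> complex mat" where
  "row_block M N = four_block_mat M N (0\<^sub>m 0 (dim_col M)) (0\<^sub>m 0 (dim_col N))"

text \<open>\<open>F(z) = D + C (zI - A)\<^sup>-\<^sup>1 B\<close> wherever \<open>zI - A\<close> is invertible, with inverse \<open>R\<close>; the values of \<open>F\<close>
  at eigenvalues of \<open>A\<close> are left unconstrained.\<close>

definition realization ::
  "(complex \<Rightarrow> complex mat) \<Rightarrow> complex mat \<Rightarrow> complex mat \<Rightarrow> complex mat \<Rightarrow> complex mat \<Rightarrow> bool" where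
  "realization F A B C D \<longleftrightarrow>
    (\<forall>z. \<forall>R \<in> carrier_mat (dim_row A) (dim_row A).
       inverts_mat (z \<cdot>\<^sub>m 1\<^sub>m (dim_row A) - A) R \<and> inverts_mat R (z \<cdot>\<^sub>m 1\<^sub>m (dim_row A) - A) \<longrightarrow>
       F z = D + C * R * B)"

definition null_solution ::
  "complex mat \<Rightarrow> complex mat \<Rightarrow> complex mat \<Rightarrow> complex mat \<Rightarrow>
   complex mat \<Rightarrow> complex mat \<Rightarrow> complex mat \<Rightarrow> bool" where
  "null_solution A B C D P H L \<longleftrightarrow>
    (\<exists>m. P \<in> carrier_mat m (dim_row A) \<and> H \<in> carrier_mat m (dim_row C) \<and> L \<in> carrier_mat m m \<and>
      row_block P H * four_block_mat A B C D = row_block (L * P) (0\<^sub>m m (dim_col B)))"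

abbreviation row_space :: "complex mat \<Rightarrow> complex vec set" where
  "row_space P \<equiv> vec_space.row_space (dim_col P) P"

definition maximal_null_solution ::
  "complex mat \<Rightarrow> complex mat \<Rightarrow> complex mat \<Rightarrow> complex mat \<Rightarrow>
   complex mat \<Rightarrow> complex mat \<Rightarrow> complex mat \<Rightarrow> bool" where
  "maximal_null_solution A B C D P H L \<longleftrightarrow>
    null_solution A B C D P H L \<and>
    (\<forall>P' H' L'. null_solution A B C D P' H' L' \<longrightarrow> row_space P' \<subseteq> row_space P)"

text \<open>Two maximal solutions have the same row space, so the description is unique.\<close>

definition V_left :: "complex mat \<Rightarrow> complex mat \<Rightarrow> complex mat \<Rightarrow> complex mat \<Rightarrow> complex vec set" where
  "V_left A B C D =
    (THE V. \<exists>P H L. maximal_null_solution A B C D P H L \<and> V = row_space P)"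

text \<open>The pairing is bilinear: \<^const>\<open>scalar_prod\<close> involves no complex conjugation.\<close>

definition row_perp :: "nat \<Rightarrow> complex vec set \<Rightarrow> complex vec set" where
  "row_perp n S = {x \<in> carrier_vec n. \<forall>s \<in> S. s \<bullet> x = 0}"

definition C_star :: "complex mat \<Rightarrow> complex mat \<Rightarrow> complex mat \<Rightarrow> complex mat \<Rightarrow> complex vec set" where
  "C_star A B C D =
    {\<xi>. \<exists>(k::nat) (u :: int \<Rightarrow> complex vec) (x :: int \<Rightarrow> complex vec).
       (\<forall>j \<in> {- int k..0}. u j \<in> carrier_vec (dim_col B)) \<and>
       x (- int k) = 0\<^sub>v (dim_row A) \<and>
       (\<forall>j \<in> {- int k..0}. x (j + 1) = A *\<^sub>v x j + B *\<^sub>v u j \<and>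
                            C *\<^sub>v x j + D *\<^sub>v u j = 0\<^sub>v (dim_row C)) \<and>
       x 1 = \<xi>}"

end

theory Submission
  imports Defs
begin

text \<open>
  Written out, a solution satisfies \<open>P A + H C = L P\<close> and \<open>P B + H D = 0\<close>. Along a trajectory with zero
  output this gives \<open>P (A x + B u) = L P x - H (C x + D u) = L P x\<close>, so \<open>P x = 0\<close> propagates from the
  initial state \<open>0\<close> to every later state. Hence \<^const>\<open>C_star\<close> lies in the kernel of the first component
  of every solution (\<open>C_star_subset_kernel\<close>).

  Conversely, \<^const>\<open>C_star\<close> is itself such a kernel. It is a subspace, hence the kernel of some
  matrix \<open>P\<close> (\<open>C_star_kernel\<close>). It is also invariant under output-nulling steps: if \<open>P x = 0\<close> and
  \<open>C x + D u = 0\<close> then \<open>P (A x + B u) = 0\<close>. In matrix terms, the kernel of the block matrix with rows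
  \<open>[P, 0]\<close> and \<open>[C, D]\<close> is contained in the kernel of \<open>[P A, P B]\<close>. By duality the latter is a left
  multiple of the former (\<open>mat_factor_if_kernel_subset\<close>), and the two blocks of the multiplier are \<open>L\<close>
  and \<open>- H\<close> for a solution with first component \<open>P\<close> (\<open>null_solution_of_C_star_kernel\<close>).

  Since inclusion of row spaces is reverse inclusion of kernels (\<open>row_space_subset_iff\<close>), the maximal
  solutions are exactly those whose kernel is the smallest possible one, \<^const>\<open>C_star\<close>
  (\<open>maximal_null_solution_iff\<close>). The linear algebra behind this is the duality between subspaces and
  their annihilators, proved by two elimination arguments in the first part.
\<close>

section \<open>Subspaces of coordinate space and their annihilators\<close>

text \<open>
  Elimination, one coordinate at a time. Let \<open>T j\<close> be the vectors of \<open>S\<close> supported on the first \<open>j\<close>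
  coordinates. Either \<open>T (Suc j) = T j\<close>, or \<open>T (Suc j)\<close> contains a vector \<open>w\<close> with \<open>w $ j = 1\<close>, and then
  \<open>x\<close> is in \<open>T (Suc j)\<close> exactly when \<open>x - x $ j \<cdot> w\<close> is in \<open>T j\<close>. Pulling the equations for \<open>T j\<close> back
  along this map gives equations for \<open>T (Suc j)\<close>.
\<close>

lemma subspace_eq_common_zeros:
  fixes S :: "'a :: field vec set"
  assumes S: "S \<subseteq> carrier_vec n" and zero: "0\<^sub>v n \<in> S"
    and add: "\<And>x y. x \<in> S \<Longrightarrow> y \<in> S \<Longrightarrow> x + y \<in> S"
    and smult: "\<And>a x. x \<in> S \<Longrightarrow> a \<cdot>\<^sub>v x \<in> S"
  shows "\<exists>R. finite R \<and> R \<subseteq> carrier_vec n \<and> S = {x \<in> carrier_vec n. \<forall>r \<in> R. r \<bullet> x = 0}"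
proof -
  define T where "T j = {x \<in> S. \<forall>i<n. j \<le> i \<longrightarrow> x $ i = 0}" for j
  have "\<exists>R. finite R \<and> R \<subseteq> carrier_vec n \<and> T j = {x \<in> carrier_vec n. \<forall>r \<in> R. r \<bullet> x = 0}"
    if "j \<le> n" for j
    using that
  proof (induction j)
    case 0
    have "T 0 = {0\<^sub>v n}"
    proof
      show "T 0 \<subseteq> {0\<^sub>v n}"
      proof
        fix x assume "x \<in> T 0"
        then have "x \<in> carrier_vec n" "\<forall>i<n. x $ i = 0" using S unfolding T_def by auto
        then have "x = 0\<^sub>v n" by (intro eq_vecI) simp_all
        then show "x \<in> {0\<^sub>v n}" by simp
      qed
      show "{0\<^sub>v n} \<subseteq> T 0" using zero unfolding T_def by simp
    qed
    moreover have "{x \<in> carrier_vec n. \<forall>r \<in> unit_vec n ` {..<n}. r \<bullet> x = 0} = {0\<^sub>v n :: 'a vec}"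
      (is "?Z = _")
    proof
      show "?Z \<subseteq> {0\<^sub>v n}"
      proof
        fix x assume x: "x \<in> ?Z"
        have "x $ i = 0" if "i < n" for i
        proof -
          have "unit_vec n i \<bullet> x = 0" using x that by blast
          then show ?thesis using x that by simp
        qed
        then have "x = 0\<^sub>v n" using x by (intro eq_vecI) simp_all
        then show "x \<in> {0\<^sub>v n}" by simp
      qed
    qed simp
    ultimately show ?case
      by (intro exI[of _ "unit_vec n ` {..<n}"]) auto
  next
    case (Suc j)
    then obtain R where R: "finite R" "R \<subseteq> carrier_vec n"
      and TR: "T j = {x \<in> carrier_vec n. \<forall>r \<in> R. r \<bullet> x = 0}" by auto
    have j: "j < n" using Suc.prems by simp
    have Tj: "x \<in> T j \<longleftrightarrow> x \<in> T (Suc j) \<and> x $ j = 0" for x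
    proof -
      have "(\<forall>i<n. j \<le> i \<longrightarrow> x $ i = 0) \<longleftrightarrow> (\<forall>i<n. Suc j \<le> i \<longrightarrow> x $ i = 0) \<and> x $ j = 0"
        using j by (metis Suc_leD Suc_leI le_refl le_neq_implies_less)
      then show ?thesis unfolding T_def by blast
    qed
    show ?case
    proof (cases "\<forall>x \<in> T (Suc j). x $ j = 0")
      case True
      then have "T (Suc j) = T j"
        using Tj by blast
      then show ?thesis using R TR by auto
    next
      case False
      then obtain v where v: "v \<in> T (Suc j)" "v $ j \<noteq> 0" by auto
      define w where "w = inverse (v $ j) \<cdot>\<^sub>v v"
      have vn: "v \<in> carrier_vec n" using v S unfolding T_def by auto
      have wT: "w \<in> T (Suc j)" and wn: "w \<in> carrier_vec n" and wj: "w $ j = 1"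
        using v vn j smult unfolding T_def w_def by auto
      have split: "x \<in> T (Suc j) \<longleftrightarrow> x + (- (x $ j)) \<cdot>\<^sub>v w \<in> T j" if x: "x \<in> carrier_vec n" for x
      proof -
        have wS: "c \<cdot>\<^sub>v w \<in> S" for c using wT smult unfolding T_def by simp
        have "x \<in> S" if "x + (- (x $ j)) \<cdot>\<^sub>v w \<in> S"
        proof -
          have "(x + (- (x $ j)) \<cdot>\<^sub>v w) + (x $ j) \<cdot>\<^sub>v w \<in> S"
            using that wS by (rule add)
          moreover have "(x + (- (x $ j)) \<cdot>\<^sub>v w) + (x $ j) \<cdot>\<^sub>v w = x"
            using x wn by (intro eq_vecI) auto
          ultimately show ?thesis by simp
        qed
        moreover have "x + (- (x $ j)) \<cdot>\<^sub>v w \<in> S" if "x \<in> S"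
          using that wS by (rule add)
        moreover have "(x + (- (x $ j)) \<cdot>\<^sub>v w) $ i = x $ i" if "i < n" "Suc j \<le> i" for i
          using wT wn x that by (simp add: T_def)
        moreover have "(x + (- (x $ j)) \<cdot>\<^sub>v w) $ j = 0"
          using wn x wj j by simp
        ultimately show ?thesis unfolding Tj by (auto simp: T_def)
      qed
      \<comment> \<open>\<open>?f\<close> is the transpose of the map \<open>x \<mapsto> x - x $ j \<cdot> w\<close>.\<close>
      let ?f = "\<lambda>r. r + (- (r \<bullet> w)) \<cdot>\<^sub>v unit_vec n j"
      have pair: "?f r \<bullet> x = r \<bullet> (x + (- (x $ j)) \<cdot>\<^sub>v w)"
        if "r \<in> R" "x \<in> carrier_vec n" for r x
      proof -
        have r: "r \<in> carrier_vec n" using that R by auto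
        show ?thesis using r that(2) wn j
          by (simp add: add_scalar_prod_distrib[of _ n] scalar_prod_add_distrib[of _ n])
      qed
      have "T (Suc j) = {x \<in> carrier_vec n. \<forall>r \<in> ?f ` R. r \<bullet> x = 0}" (is "_ = ?Z")
      proof (rule Set.set_eqI)
        fix x
        show "x \<in> T (Suc j) \<longleftrightarrow> x \<in> ?Z"
        proof (cases "x \<in> carrier_vec n")
          case True
          then show ?thesis using wn by (simp add: split TR pair)
        next
          case False
          then show ?thesis using S unfolding T_def by auto
        qed
      qed
      then show ?thesis using R by (intro exI[of _ "?f ` R"]) auto
    qed
  qed
  from this[of n] show ?thesis unfolding T_def by auto
qed

text \<open>
  The induction removes one functional \<open>s\<close>. If \<open>s\<close> already vanishes where \<open>R\<close> does, it adds no
  condition and \<open>R\<close> alone suffices. Otherwise some common zero \<open>z\<close> of \<open>R\<close> has \<open>s \<bullet> z \<noteq> 0\<close>; every common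
  zero of \<open>R\<close> is then a common zero of \<open>insert s R\<close> plus a multiple of \<open>z\<close>, and subtracting from \<open>v\<close> the
  multiple of \<open>s\<close> that makes it vanish at \<open>z\<close> reduces the claim to \<open>R\<close>.
\<close>

lemma (in vec_space) in_span_if_vanishes_on_common_zeros:
  assumes "finite R" "R \<subseteq> carrier_vec n" "v \<in> carrier_vec n"
    and "\<And>x. x \<in> carrier_vec n \<Longrightarrow> \<forall>r \<in> R. r \<bullet> x = 0 \<Longrightarrow> v \<bullet> x = 0"
  shows "v \<in> span R"
  using assms
proof (induction R arbitrary: v rule: finite_induct)
  case empty
  have "v = 0\<^sub>v n"
  proof (rule eq_vecI)
    fix i assume "i < dim_vec (0\<^sub>v n)"
    then have "i < n" by simp
    then show "v $ i = 0\<^sub>v n $ i"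
      using empty(2) empty(3)[of "unit_vec n i"] by simp
  qed (use empty in auto)
  then show ?case by (simp add: span_empty)
next
  case (insert s R)
  have s: "s \<in> carrier_vec n" and R: "R \<subseteq> carrier_vec n" using insert.prems by auto
  have mono: "span R \<subseteq> span (insert s R)" by (rule span_is_monotone) auto
  show ?case
  proof (cases "\<forall>x \<in> carrier_vec n. (\<forall>r \<in> R. r \<bullet> x = 0) \<longrightarrow> s \<bullet> x = 0")
    case True
    then have "v \<in> span R" using insert R by auto
    then show ?thesis using mono by auto
  next
    case False
    then obtain z where z: "z \<in> carrier_vec n" "\<forall>r \<in> R. r \<bullet> z = 0" "s \<bullet> z \<noteq> 0" by auto
    define c where "c = v \<bullet> z / (s \<bullet> z)"
    define v' where "v' = v + (- c) \<cdot>\<^sub>v s"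
    have "v' \<in> span R"
    proof (rule insert.IH[OF R])
      show "v' \<in> carrier_vec n" using s insert.prems unfolding v'_def by auto
      fix x assume x: "x \<in> carrier_vec n" "\<forall>r \<in> R. r \<bullet> x = 0"
      let ?y = "x + (- (s \<bullet> x / (s \<bullet> z))) \<cdot>\<^sub>v z"
      have "v \<bullet> ?y = 0"
      proof (rule insert.prems(3))
        show "?y \<in> carrier_vec n" using x z by auto
        have "r \<bullet> ?y = 0" if "r \<in> R" for r
        proof -
          have "r \<in> carrier_vec n" using that R by auto
          then show ?thesis using that x z by (simp add: scalar_prod_add_distrib[of _ n])
        qed
        moreover have "s \<bullet> ?y = 0"
          using s x z by (simp add: scalar_prod_add_distrib[of _ n])
        ultimately show "\<forall>r \<in> insert s R. r \<bullet> ?y = 0" by auto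
      qed
      then show "v' \<bullet> x = 0"
        using s x z insert.prems(2) unfolding v'_def c_def
        by (simp add: scalar_prod_add_distrib[of _ n] add_scalar_prod_distrib[of _ n] field_simps)
    qed
    then have "v' \<in> span (insert s R)" using mono by auto
    moreover have "s \<in> span (insert s R)" using s R by (intro span_mem) auto
    then have "c \<cdot>\<^sub>v s \<in> span (insert s R)" using s R by (intro smult_in_span) auto
    ultimately have "v' + c \<cdot>\<^sub>v s \<in> span (insert s R)" using s R by (intro span_add1) auto
    moreover have "v' + c \<cdot>\<^sub>v s = v"
      using s insert.prems(2) unfolding v'_def by (intro eq_vecI) auto
    ultimately show ?thesis by simp
  qed
qed

section \<open>Row spaces, kernels and factorizations\<close>

lemma mult_mat_zero_vec:
  "M \<in> carrier_mat r c \<Longrightarrow> M *\<^sub>v 0\<^sub>v c = (0\<^sub>v r :: 'a :: semiring_0 vec)"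
  by (intro eq_vecI) auto

lemma zero_mat_mult_vec:
  "u \<in> carrier_vec c \<Longrightarrow> 0\<^sub>m r c *\<^sub>v u = (0\<^sub>v r :: 'a :: semiring_0 vec)"
  by (intro eq_vecI) auto

lemma row_space_eq_image:
  assumes "P \<in> carrier_mat m n"
  shows "row_space P = (\<lambda>y. transpose_mat P *\<^sub>v y) ` carrier_vec m"
proof -
  interpret vec_space "TYPE(complex)" n .
  show ?thesis using assms row_space_eq[OF assms] by auto
qed

lemma row_perp_row_space:
  assumes P: "P \<in> carrier_mat m n"
  shows "row_perp n (row_space P) = mat_kernel P"
proof -
  have pair: "(transpose_mat P *\<^sub>v y) \<bullet> x = y \<bullet> (P *\<^sub>v x)"
    if "y \<in> carrier_vec m" "x \<in> carrier_vec n" for x y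
    using that P transpose_vec_mult_scalar[of P m n x y] by simp
  have "P *\<^sub>v x = 0\<^sub>v m \<longleftrightarrow> (\<forall>y \<in> carrier_vec m. y \<bullet> (P *\<^sub>v x) = 0)"
    if "x \<in> carrier_vec n" for x
  proof
    assume "\<forall>y \<in> carrier_vec m. y \<bullet> (P *\<^sub>v x) = 0"
    then have unit: "unit_vec m i \<bullet> (P *\<^sub>v x) = 0" for i by simp
    have Px: "P *\<^sub>v x \<in> carrier_vec m" using P that by simp
    show "P *\<^sub>v x = 0\<^sub>v m"
    proof (rule eq_vecI)
      fix i assume "i < dim_vec (0\<^sub>v m :: complex vec)"
      then have i: "i < m" by simp
      have "(P *\<^sub>v x) $ i = 0" using unit[of i] scalar_prod_left_unit[OF Px i] by simp
      then show "(P *\<^sub>v x) $ i = (0\<^sub>v m :: complex vec) $ i" using i by simp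
    qed (use P in simp)
  qed auto
  then show ?thesis
    unfolding row_perp_def row_space_eq_image[OF P] mat_kernel[OF P] by (auto simp: pair)
qed

text \<open>
  The kernel is the annihilator of the row space, so one direction is immediate; the other is the
  statement that a finitely generated row space is its own double annihilator.
\<close>

lemma row_space_subset_iff:
  assumes P: "P \<in> carrier_mat m n" and Q: "Q \<in> carrier_mat k n"
  shows "row_space Q \<subseteq> row_space P \<longleftrightarrow> mat_kernel P \<subseteq> mat_kernel Q"
proof
  assume "row_space Q \<subseteq> row_space P"
  then show "mat_kernel P \<subseteq> mat_kernel Q"
    unfolding row_perp_row_space[OF P, symmetric] row_perp_row_space[OF Q, symmetric]
    by (auto simp: row_perp_def)
next
  assume ker: "mat_kernel P \<subseteq> mat_kernel Q"
  have rs: "set (rows P) \<subseteq> carrier_vec n" using P by (auto simp: rows_def)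
  show "row_space Q \<subseteq> row_space P"
  proof
    fix v assume v: "v \<in> row_space Q"
    have vn: "v \<in> carrier_vec n" using v Q unfolding row_space_eq_image[OF Q] by auto
    have "v \<in> LinearCombinations.module.span class_ring (module_vec TYPE(complex) n) (set (rows P))"
    proof (rule vec_space.in_span_if_vanishes_on_common_zeros[OF _ rs vn])
      fix x assume x: "x \<in> carrier_vec n" "\<forall>r \<in> set (rows P). r \<bullet> x = 0"
      then have "P *\<^sub>v x = 0\<^sub>v m" using P by (intro eq_vecI) (auto simp: rows_def)
      then have "x \<in> mat_kernel Q" using ker x P by (auto intro: mat_kernelI)
      then show "v \<bullet> x = 0"
        using v unfolding row_perp_row_space[OF Q, symmetric] row_perp_def by auto
    qed simp
    then show "v \<in> row_space P" using P unfolding vec_space.row_space_def by simp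
  qed
qed

text \<open>
  Each row of \<open>N\<close> lies in the row space of \<open>M\<close>; its coefficients in terms of the rows of \<open>M\<close> form the
  corresponding row of the factor.
\<close>

lemma mat_factor_if_kernel_subset:
  assumes M: "M \<in> carrier_mat m n" and N: "N \<in> carrier_mat k n"
    and ker: "mat_kernel M \<subseteq> mat_kernel N"
  shows "\<exists>X \<in> carrier_mat k m. N = X * (M :: complex mat)"
proof -
  have "row N i \<in> row_space M" if "i < k" for i
  proof -
    have "transpose_mat N *\<^sub>v unit_vec k i = row N i"
      using N that by (intro eq_vecI) auto
    then have "row N i \<in> row_space N"
      unfolding row_space_eq_image[OF N] by (metis image_eqI unit_vec_carrier)
    then show ?thesis using ker row_space_subset_iff[OF M N] by auto
  qed
  then have "\<forall>i. \<exists>y \<in> carrier_vec m. i < k \<longrightarrow> row N i = transpose_mat M *\<^sub>v y"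
    unfolding row_space_eq_image[OF M] by (metis imageE zero_carrier_vec)
  then obtain y where y: "\<And>i. y i \<in> carrier_vec m"
    "\<And>i. i < k \<Longrightarrow> row N i = transpose_mat M *\<^sub>v y i" by metis
  define X where "X = mat k m (\<lambda>(i,j). y i $ j)"
  have X: "X \<in> carrier_mat k m" unfolding X_def by simp
  have "N = X * M"
  proof (rule eq_matI)
    fix i j assume "i < dim_row (X * M)" "j < dim_col (X * M)"
    then have ij: "i < k" "j < n" using X M by auto
    have "row X i = y i" using ij y(1)[of i] unfolding X_def by (intro eq_vecI) auto
    moreover have "N $$ (i, j) = row N i $ j" using N ij by simp
    moreover have "row N i $ j = col M j \<bullet> y i" using y(2)[OF ij(1)] M ij by simp
    moreover have "col M j \<bullet> y i = y i \<bullet> col M j"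
      using M ij y(1) by (intro comm_scalar_prod[of _ m]) auto
    ultimately show "N $$ (i, j) = (X * M) $$ (i, j)" using X M ij by simp
  qed (use X M N in auto)
  then show ?thesis using X by blast
qed

lemma subspace_is_mat_kernel:
  fixes S :: "complex vec set"
  assumes "S \<subseteq> carrier_vec n" "0\<^sub>v n \<in> S"
    "\<And>x y. x \<in> S \<Longrightarrow> y \<in> S \<Longrightarrow> x + y \<in> S" "\<And>a x. x \<in> S \<Longrightarrow> a \<cdot>\<^sub>v x \<in> S"
  shows "\<exists>m. \<exists>P \<in> carrier_mat m n. mat_kernel P = S"
proof -
  obtain R where R: "finite R" "R \<subseteq> carrier_vec n"
    and S: "S = {x \<in> carrier_vec n. \<forall>r \<in> R. r \<bullet> x = 0}"
    using subspace_eq_common_zeros[OF assms] by blast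
  obtain rs where rs: "set rs = R" using R finite_list by blast
  let ?P = "mat_of_rows n rs"
  have P: "?P \<in> carrier_mat (length rs) n" by simp
  have "mat_kernel ?P = S"
  proof (rule Set.set_eqI)
    fix x
    have "?P *\<^sub>v x = 0\<^sub>v (length rs) \<longleftrightarrow> (\<forall>i < length rs. (rs ! i) \<bullet> x = 0)"
    proof -
      have "row ?P i = rs ! i" if "i < length rs" for i
        using that R rs by (intro mat_of_rows_row) auto
      then show ?thesis by (auto simp: vec_eq_iff)
    qed
    then show "x \<in> mat_kernel ?P \<longleftrightarrow> x \<in> S"
      unfolding mat_kernel[OF P] S rs[symmetric] by (auto simp: all_set_conv_all_nth)
  qed
  then show ?thesis using P by blast
qed

section \<open>Matrices in block-row form\<close>

lemma row_block_eq_iff: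
  assumes "M \<in> carrier_mat m a" "M' \<in> carrier_mat m a" "N \<in> carrier_mat m b" "N' \<in> carrier_mat m b"
  shows "row_block M N = row_block M' N' \<longleftrightarrow> M = M' \<and> N = N'"
proof
  assume eq: "row_block M N = row_block M' N'"
  have "M $$ (i, j) = M' $$ (i, j)" if "i < m" "j < a" for i j
    using arg_cong[OF eq, of "\<lambda>Z. Z $$ (i, j)"] assms that by (simp add: row_block_def)
  moreover have "N $$ (i, j) = N' $$ (i, j)" if "i < m" "j < b" for i j
    using arg_cong[OF eq, of "\<lambda>Z. Z $$ (i, a + j)"] assms that by (simp add: row_block_def)
  ultimately show "M = M' \<and> N = N'" using assms by auto
qed simp

lemma row_block_mult_four_block:
  assumes L: "L \<in> carrier_mat m a" and H: "H \<in> carrier_mat m b"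
    and "M1 \<in> carrier_mat a n1" "M2 \<in> carrier_mat a n2"
    and "M3 \<in> carrier_mat b n1" "M4 \<in> carrier_mat b n2"
  shows "row_block L H * four_block_mat M1 M2 M3 M4
    = row_block (L * M1 + H * M3) (L * M2 + H * M4)"
proof -
  have "row_block L H = four_block_mat L H (0\<^sub>m 0 a) (0\<^sub>m 0 b)"
    using L H by (simp add: row_block_def)
  then show ?thesis
    using mult_four_block_mat[OF L H, of "0\<^sub>m 0 a" 0 "0\<^sub>m 0 b" M1 n1 M2 n2 M3 M4] assms
    by (simp add: row_block_def)
qed

section \<open>Controllability along zero output\<close>

text \<open>
  States reachable from \<open>0\<close> in exactly \<open>k\<close> output-nulling steps. The step-by-step form replaces the
  trajectories indexed by \<open>-k, \<dots>, 0\<close> of \<^const>\<open>C_star\<close> and makes induction along them available.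
\<close>

inductive reach_with_zero_output ::
  "complex mat \<Rightarrow> complex mat \<Rightarrow> complex mat \<Rightarrow> complex mat \<Rightarrow> nat \<Rightarrow> complex vec \<Rightarrow> bool"
  for A B C D where
  start: "reach_with_zero_output A B C D 0 (0\<^sub>v (dim_row A))"
| step: "reach_with_zero_output A B C D k x \<Longrightarrow> u \<in> carrier_vec (dim_col B) \<Longrightarrow>
    C *\<^sub>v x + D *\<^sub>v u = 0\<^sub>v (dim_row C) \<Longrightarrow>
    reach_with_zero_output A B C D (Suc k) (A *\<^sub>v x + B *\<^sub>v u)"

inductive_cases reach_zeroE: "reach_with_zero_output A B C D 0 x"
inductive_cases reach_SucE: "reach_with_zero_output A B C D (Suc k) x"

locale discrete_system =
  fixes A B C D :: "complex mat" and n p q :: nat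
  assumes A: "A \<in> carrier_mat n n" and B: "B \<in> carrier_mat n q"
    and C: "C \<in> carrier_mat p n" and D: "D \<in> carrier_mat p q"
begin

abbreviation reach :: "nat \<Rightarrow> complex vec \<Rightarrow> bool" where
  "reach \<equiv> reach_with_zero_output A B C D"

lemma reach_carrier: "reach k x \<Longrightarrow> x \<in> carrier_vec n"
  by (induction rule: reach_with_zero_output.induct) (use A B in auto)

lemma reach_zero: "reach 0 (0\<^sub>v n)"
  using reach_with_zero_output.start[of A B C D] A by simp

lemma reach_step:
  assumes "reach k x" "u \<in> carrier_vec q" "C *\<^sub>v x + D *\<^sub>v u = 0\<^sub>v p"
  shows "reach (Suc k) (A *\<^sub>v x + B *\<^sub>v u)"
  using reach_with_zero_output.step[OF assms(1), of u] assms B C by simp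

lemma reach_Suc_cases:
  assumes "reach (Suc k) x"
  obtains y u where "reach k y" "u \<in> carrier_vec q" "C *\<^sub>v y + D *\<^sub>v u = 0\<^sub>v p"
    "x = A *\<^sub>v y + B *\<^sub>v u"
  using assms B C by (elim reach_SucE) auto

text \<open>
  Waiting at the origin with zero input produces zero output, so a trajectory can be delayed. This
  brings two trajectories to a common length before they are superposed.
\<close>

lemma reach_Suc: "reach k x \<Longrightarrow> reach (Suc k) x"
proof (induction k arbitrary: x)
  case 0
  then have "x = 0\<^sub>v n" using A by (elim reach_zeroE) auto
  moreover have "reach (Suc 0) (A *\<^sub>v 0\<^sub>v n + B *\<^sub>v 0\<^sub>v q)"
    using mult_mat_zero_vec[OF C] mult_mat_zero_vec[OF D]
    by (intro reach_step reach_zero) auto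
  ultimately show ?case using mult_mat_zero_vec[OF A] mult_mat_zero_vec[OF B] by simp
next
  case (Suc k)
  from Suc.prems show ?case
    by (rule reach_Suc_cases) (use Suc.IH reach_step in auto)
qed

lemma reach_add_steps: "reach k x \<Longrightarrow> reach (k + l) x"
  by (induction l) (auto intro: reach_Suc)

lemma reach_lincomb:
  assumes "reach k x" "reach k y"
  shows "reach k (a \<cdot>\<^sub>v x + b \<cdot>\<^sub>v y)"
  using assms
proof (induction k arbitrary: x y)
  case 0
  then have "x = 0\<^sub>v n" "y = 0\<^sub>v n" using A by (auto elim: reach_zeroE)
  moreover have "a \<cdot>\<^sub>v 0\<^sub>v n + b \<cdot>\<^sub>v 0\<^sub>v n = (0\<^sub>v n :: complex vec)" by (intro eq_vecI) auto
  ultimately show ?case using reach_zero by simp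
next
  case (Suc k)
  from Suc.prems(1) obtain x' u where x': "reach k x'" "u \<in> carrier_vec q"
    "C *\<^sub>v x' + D *\<^sub>v u = 0\<^sub>v p" "x = A *\<^sub>v x' + B *\<^sub>v u" by (rule reach_Suc_cases)
  from Suc.prems(2) obtain y' v where y': "reach k y'" "v \<in> carrier_vec q"
    "C *\<^sub>v y' + D *\<^sub>v v = 0\<^sub>v p" "y = A *\<^sub>v y' + B *\<^sub>v v" by (rule reach_Suc_cases)
  note car = x'(2) y'(2) reach_carrier[OF x'(1)] reach_carrier[OF y'(1)]
  have comb: "M *\<^sub>v (a \<cdot>\<^sub>v x' + b \<cdot>\<^sub>v y') + N *\<^sub>v (a \<cdot>\<^sub>v u + b \<cdot>\<^sub>v v)
      = a \<cdot>\<^sub>v (M *\<^sub>v x' + N *\<^sub>v u) + b \<cdot>\<^sub>v (M *\<^sub>v y' + N *\<^sub>v v)"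
    if "M \<in> carrier_mat r n" "N \<in> carrier_mat r q" for M N r
  proof -
    have "M *\<^sub>v (a \<cdot>\<^sub>v x' + b \<cdot>\<^sub>v y') = a \<cdot>\<^sub>v (M *\<^sub>v x') + b \<cdot>\<^sub>v (M *\<^sub>v y')"
      using that car by (simp add: mult_add_distrib_mat_vec[of _ r n] mult_mat_vec[of _ r n])
    moreover have "N *\<^sub>v (a \<cdot>\<^sub>v u + b \<cdot>\<^sub>v v) = a \<cdot>\<^sub>v (N *\<^sub>v u) + b \<cdot>\<^sub>v (N *\<^sub>v v)"
      using that car by (simp add: mult_add_distrib_mat_vec[of _ r q] mult_mat_vec[of _ r q])
    ultimately show ?thesis
      using that by (auto intro!: eq_vecI simp: algebra_simps simp del: index_mult_mat_vec)
  qed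
  have "reach (Suc k) (A *\<^sub>v (a \<cdot>\<^sub>v x' + b \<cdot>\<^sub>v y') + B *\<^sub>v (a \<cdot>\<^sub>v u + b \<cdot>\<^sub>v v))"
    using Suc.IH[OF x'(1) y'(1)] car comb[OF C D] x'(3) y'(3) by (intro reach_step) auto
  then show ?case using comb[OF A B] x'(4) y'(4) by simp
qed

lemma reach_trajectory:
  assumes "reach k \<xi>"
  shows "\<exists>(u :: nat \<Rightarrow> complex vec) x. x 0 = 0\<^sub>v n \<and> x k = \<xi> \<and>
    (\<forall>i<k. u i \<in> carrier_vec q \<and> x (Suc i) = A *\<^sub>v x i + B *\<^sub>v u i \<and>
      C *\<^sub>v x i + D *\<^sub>v u i = 0\<^sub>v p)"
  using assms
proof (induction k arbitrary: \<xi>)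
  case 0
  then show ?case using A by (intro exI[of _ "\<lambda>_. \<xi>"]) (auto elim: reach_zeroE)
next
  case (Suc k)
  from Suc.prems obtain y w where y: "reach k y" "w \<in> carrier_vec q"
    "C *\<^sub>v y + D *\<^sub>v w = 0\<^sub>v p" "\<xi> = A *\<^sub>v y + B *\<^sub>v w" by (rule reach_Suc_cases)
  from Suc.IH[OF y(1)] obtain u x where "x 0 = 0\<^sub>v n" "x k = y"
    "\<forall>i<k. u i \<in> carrier_vec q \<and> x (Suc i) = A *\<^sub>v x i + B *\<^sub>v u i \<and>
      C *\<^sub>v x i + D *\<^sub>v u i = 0\<^sub>v p" by blast
  with y show ?case
    by (intro exI[of _ "u(k := w)"] exI[of _ "x(Suc k := \<xi>)"]) (auto simp: less_Suc_eq)
qed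

text \<open>
  Time \<open>j\<close> corresponds to step number \<open>j + k\<close>. The states of a trajectory run from time \<open>-k\<close> to time \<open>1\<close>,
  so it has \<open>k + 1\<close> steps; the case of zero steps is covered by delaying.
\<close>

lemma C_star_eq_reach: "C_star A B C D = {\<xi>. \<exists>k. reach k \<xi>}"
proof (intro Set.set_eqI iffI)
  fix \<xi> assume "\<xi> \<in> C_star A B C D"
  then obtain k :: nat and u x :: "int \<Rightarrow> complex vec" where
    u: "\<forall>j \<in> {- int k..0}. u j \<in> carrier_vec q" and x0: "x (- int k) = 0\<^sub>v n" and
    x: "\<forall>j \<in> {- int k..0}. x (j + 1) = A *\<^sub>v x j + B *\<^sub>v u j \<and> C *\<^sub>v x j + D *\<^sub>v u j = 0\<^sub>v p"
    and x1: "x 1 = \<xi>"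
    using A B C unfolding C_star_def by auto
  have "reach i (x (int i - int k))" if "i \<le> Suc k" for i
    using that
  proof (induction i)
    case 0
    then show ?case using reach_zero x0 by simp
  next
    case (Suc i)
    let ?j = "int i - int k"
    have j: "?j \<in> {- int k..0}" using Suc.prems by simp
    have "reach (Suc i) (A *\<^sub>v x ?j + B *\<^sub>v u ?j)"
      using Suc u x j by (intro reach_step) auto
    moreover have "x (?j + 1) = A *\<^sub>v x ?j + B *\<^sub>v u ?j" using x j by auto
    moreover have "int (Suc i) - int k = ?j + 1" by simp
    ultimately show ?case by (simp only:)
  qed
  from this[of "Suc k"] x1 show "\<xi> \<in> {\<xi>. \<exists>k. reach k \<xi>}" by auto
next
  fix \<xi> assume "\<xi> \<in> {\<xi>. \<exists>k. reach k \<xi>}"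
  then obtain k where "reach (Suc k) \<xi>" using reach_Suc by auto
  from reach_trajectory[OF this] obtain u :: "nat \<Rightarrow> complex vec" and x where
    x: "x 0 = 0\<^sub>v n" "x (Suc k) = \<xi>"
    "\<forall>i<Suc k. u i \<in> carrier_vec q \<and> x (Suc i) = A *\<^sub>v x i + B *\<^sub>v u i \<and>
      C *\<^sub>v x i + D *\<^sub>v u i = 0\<^sub>v p" by blast
  let ?u = "\<lambda>j::int. u (nat (j + int k))" and ?x = "\<lambda>j::int. x (nat (j + int k))"
  have "?u j \<in> carrier_vec q \<and> ?x (j + 1) = A *\<^sub>v ?x j + B *\<^sub>v ?u j \<and>
      C *\<^sub>v ?x j + D *\<^sub>v ?u j = 0\<^sub>v p" if "j \<in> {- int k..0}" for j
  proof -
    have "nat (j + 1 + int k) = Suc (nat (j + int k))" "nat (j + int k) < Suc k"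
      using that by auto
    then show ?thesis using x(3) by simp
  qed
  moreover have "?x 1 = \<xi>" "?x (- int k) = 0\<^sub>v n" using x by (simp_all add: nat_add_distrib)
  ultimately show "\<xi> \<in> C_star A B C D"
    using A B C unfolding C_star_def
    by (intro CollectI exI[of _ k] exI[of _ ?u] exI[of _ ?x]) auto
qed

lemma C_star_kernel:
  obtains m P where "P \<in> carrier_mat m n" "mat_kernel P = C_star A B C D"
proof -
  have "\<exists>m. \<exists>P \<in> carrier_mat m n. mat_kernel P = C_star A B C D"
  proof (rule subspace_is_mat_kernel)
    show "C_star A B C D \<subseteq> carrier_vec n" "0\<^sub>v n \<in> C_star A B C D"
      using reach_carrier reach_zero unfolding C_star_eq_reach by auto
  next
    fix x y assume "x \<in> C_star A B C D" "y \<in> C_star A B C D"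
    then obtain k l where kl: "reach k x" "reach l y" unfolding C_star_eq_reach by auto
    then have "reach (k + l) (1 \<cdot>\<^sub>v x + 1 \<cdot>\<^sub>v y)"
      using reach_add_steps[of k x l] reach_add_steps[of l y k]
      by (intro reach_lincomb) (auto simp: add.commute)
    then show "x + y \<in> C_star A B C D" unfolding C_star_eq_reach by auto
  next
    fix a x assume "x \<in> C_star A B C D"
    then obtain k where k: "reach k x" unfolding C_star_eq_reach by auto
    have "a \<cdot>\<^sub>v x + 0 \<cdot>\<^sub>v x = a \<cdot>\<^sub>v x" using reach_carrier[OF k] by (intro eq_vecI) auto
    then show "a \<cdot>\<^sub>v x \<in> C_star A B C D"
      using reach_lincomb[OF k k, of a 0] unfolding C_star_eq_reach by auto
  qed
  then show ?thesis using that by blast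
qed

section \<open>Solutions of the matrix equation\<close>

lemma null_solution_iff:
  "null_solution A B C D P H L \<longleftrightarrow>
    (\<exists>m. P \<in> carrier_mat m n \<and> H \<in> carrier_mat m p \<and> L \<in> carrier_mat m m \<and>
      P * A + H * C = L * P \<and> P * B + H * D = 0\<^sub>m m q)"
proof -
  have "row_block P H * four_block_mat A B C D = row_block (L * P) (0\<^sub>m m q) \<longleftrightarrow>
      P * A + H * C = L * P \<and> P * B + H * D = 0\<^sub>m m q"
    if "P \<in> carrier_mat m n" "H \<in> carrier_mat m p" "L \<in> carrier_mat m m" for m
    using that A B C D
    by (subst row_block_mult_four_block[of P m n H p A n B q C D], simp_all,
        subst row_block_eq_iff[of _ m n _ _ q]) auto
  then show ?thesis using A B C unfolding null_solution_def by auto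
qed

text \<open>
  Multiplying an output-nulling step from \<open>y\<close> to \<open>x\<close> by \<open>[P, H]\<close> from the left gives \<open>P x = L P y\<close>.
\<close>

lemma C_star_subset_kernel:
  assumes "null_solution A B C D P H L"
  shows "C_star A B C D \<subseteq> mat_kernel P"
proof -
  from assms obtain m where P: "P \<in> carrier_mat m n" and H: "H \<in> carrier_mat m p"
    and L: "L \<in> carrier_mat m m" and eqA: "P * A + H * C = L * P"
    and eqB: "P * B + H * D = 0\<^sub>m m q" unfolding null_solution_iff by auto
  have "P *\<^sub>v x = 0\<^sub>v m" if "reach k x" for k x
    using that
  proof (induction k arbitrary: x)
    case 0
    then have "x = 0\<^sub>v n" using A by (auto elim: reach_zeroE)
    then show ?case using mult_mat_zero_vec[OF P] by simp
  next
    case (Suc k)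
    from Suc.prems obtain y u where y: "reach k y" "u \<in> carrier_vec q"
      "C *\<^sub>v y + D *\<^sub>v u = 0\<^sub>v p" "x = A *\<^sub>v y + B *\<^sub>v u" by (rule reach_Suc_cases)
    have yn: "y \<in> carrier_vec n" using reach_carrier[OF y(1)] .
    have "P *\<^sub>v x + H *\<^sub>v (C *\<^sub>v y + D *\<^sub>v u) = (P * A + H * C) *\<^sub>v y + (P * B + H * D) *\<^sub>v u"
    proof -
      have "P *\<^sub>v x = (P * A) *\<^sub>v y + (P * B) *\<^sub>v u"
        unfolding y(4) using P A B yn y(2) by (simp add: mult_add_distrib_mat_vec[of _ m n] assoc_mult_mat_vec[of _ m n _ ])
      moreover have "H *\<^sub>v (C *\<^sub>v y + D *\<^sub>v u) = (H * C) *\<^sub>v y + (H * D) *\<^sub>v u"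
        using H C D yn y(2) by (simp add: mult_add_distrib_mat_vec[of _ m p] assoc_mult_mat_vec[of _ m p _ ])
      moreover have "(P * A + H * C) *\<^sub>v y = (P * A) *\<^sub>v y + (H * C) *\<^sub>v y"
        using P A H C yn by (intro add_mult_distrib_mat_vec[of _ m n]) auto
      moreover have "(P * B + H * D) *\<^sub>v u = (P * B) *\<^sub>v u + (H * D) *\<^sub>v u"
        using P B H D y(2) by (intro add_mult_distrib_mat_vec[of _ m q]) auto
      ultimately show ?thesis using P A B H C D
        by (intro eq_vecI) (simp_all del: index_mult_mat_vec)
    qed
    also have "\<dots> = L *\<^sub>v (P *\<^sub>v y)"
      unfolding eqA eqB using L P yn y(2) by (simp add: zero_mat_mult_vec assoc_mult_mat_vec[of _ m m])
    also have "\<dots> = 0\<^sub>v m" using Suc.IH[OF y(1)] mult_mat_zero_vec[OF L] by simp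
    finally show ?case
      using y(3) P reach_carrier[OF Suc.prems] mult_mat_zero_vec[OF H] by simp
  qed
  then show ?thesis
    unfolding C_star_eq_reach mat_kernel[OF P] using reach_carrier by auto
qed

text \<open>
  Invariance of \<^const>\<open>C_star\<close> under output-nulling steps is a kernel inclusion between the block matrices
  \<open>M\<close> and \<open>N\<close>, and the factor that it provides contains \<open>L\<close> and \<open>- H\<close>.
\<close>

lemma null_solution_of_C_star_kernel:
  assumes P: "P \<in> carrier_mat m n" and ker: "mat_kernel P = C_star A B C D"
  shows "\<exists>H L. null_solution A B C D P H L"
proof -
  define M where "M = four_block_mat P (0\<^sub>m m q) C D"
  define N where "N = row_block (P * A) (P * B)"
  have M: "M \<in> carrier_mat (m + p) (n + q)" using P D unfolding M_def by simp
  have Neq: "N = four_block_mat (P * A) (P * B) (0\<^sub>m 0 n) (0\<^sub>m 0 q)"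
    using P A B unfolding N_def row_block_def by simp
  have N: "N \<in> carrier_mat m (n + q)" using P A B unfolding Neq by auto
  have "mat_kernel M \<subseteq> mat_kernel N"
  proof
    fix v assume v: "v \<in> mat_kernel M"
    define x u where "x = vec_first v n" and "u = vec_last v q"
    have vc: "v \<in> carrier_vec (n + q)" using mat_kernelD[OF M v] by simp
    have xu: "v = x @\<^sub>v u" "x \<in> carrier_vec n" "u \<in> carrier_vec q"
      using vc unfolding x_def u_def by auto
    have "M *\<^sub>v v = (P *\<^sub>v x + 0\<^sub>m m q *\<^sub>v u) @\<^sub>v (C *\<^sub>v x + D *\<^sub>v u)"
      unfolding M_def xu(1) using P C D xu by (intro four_block_mat_mult_vec) auto
    moreover have "M *\<^sub>v v = 0\<^sub>v m @\<^sub>v 0\<^sub>v p" 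
      using mat_kernelD(2)[OF M v] by (auto intro!: eq_vecI)
    ultimately have "(P *\<^sub>v x + 0\<^sub>m m q *\<^sub>v u) @\<^sub>v (C *\<^sub>v x + D *\<^sub>v u) = 0\<^sub>v m @\<^sub>v 0\<^sub>v p"
      by simp
    moreover have "P *\<^sub>v x + 0\<^sub>m m q *\<^sub>v u = P *\<^sub>v x"
      using P xu by (simp add: zero_mat_mult_vec)
    ultimately have Px: "P *\<^sub>v x = 0\<^sub>v m" and y: "C *\<^sub>v x + D *\<^sub>v u = 0\<^sub>v p"
      using append_vec_eq[of "P *\<^sub>v x" m "0\<^sub>v m"] P xu by auto
    have "x \<in> C_star A B C D" using Px P xu ker by (auto intro: mat_kernelI)
    then have "A *\<^sub>v x + B *\<^sub>v u \<in> mat_kernel P"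
      using reach_step y xu unfolding ker C_star_eq_reach by blast
    then have "P *\<^sub>v (A *\<^sub>v x + B *\<^sub>v u) = 0\<^sub>v m" using mat_kernelD[OF P] by simp
    then have "(P * A) *\<^sub>v x + (P * B) *\<^sub>v u = 0\<^sub>v m"
      using P A B xu by (simp add: mult_add_distrib_mat_vec[of _ m n] assoc_mult_mat_vec[of _ m n _])
    moreover have "N *\<^sub>v v = ((P * A) *\<^sub>v x + (P * B) *\<^sub>v u) @\<^sub>v (0\<^sub>m 0 n *\<^sub>v x + 0\<^sub>m 0 q *\<^sub>v u)"
      unfolding Neq xu(1) using P A B xu by (intro four_block_mat_mult_vec) auto
    ultimately have "N *\<^sub>v v = 0\<^sub>v m" using xu by (auto intro!: eq_vecI)
    then show "v \<in> mat_kernel N" using N vc by (intro mat_kernelI)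
  qed
  then obtain X where X: "X \<in> carrier_mat m (m + p)" "N = X * M"
    using mat_factor_if_kernel_subset[OF M N] by blast
  define L where "L = mat m m (\<lambda>(i, j). X $$ (i, j))"
  define G where "G = mat m p (\<lambda>(i, j). X $$ (i, m + j))"
  have LG: "L \<in> carrier_mat m m" "G \<in> carrier_mat m p" unfolding L_def G_def by auto
  have "X = row_block L G"
    using X(1) by (intro eq_matI) (auto simp: row_block_def L_def G_def)
  then have "row_block (P * A) (P * B) = row_block (L * P + G * C) (L * 0\<^sub>m m q + G * D)"
    using X(2) row_block_mult_four_block[OF LG, of P n "0\<^sub>m m q" q C D] P C D
    unfolding N_def M_def by simp
  then have eq: "P * A = L * P + G * C" "P * B = G * D"
    using P A B C D LG row_block_eq_iff[of "P * A" m n "L * P + G * C" "P * B" q "L * 0\<^sub>m m q + G * D"]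
    by auto
  have "P * A + - G * C = L * P" "P * B + - G * D = 0\<^sub>m m q"
    unfolding eq using P C D LG by (auto intro!: eq_matI)
  then have "null_solution A B C D P (- G) L"
    unfolding null_solution_iff using P LG by (intro exI[of _ m]) auto
  then show ?thesis by blast
qed

text \<open>
  All kernels of solutions contain \<^const>\<open>C_star\<close>, and one of them equals it; under the reversal between
  row spaces and kernels, that is the condition for being maximal.
\<close>

lemma maximal_null_solution_iff:
  "maximal_null_solution A B C D P H L \<longleftrightarrow>
    null_solution A B C D P H L \<and> mat_kernel P = C_star A B C D"
proof
  assume max: "maximal_null_solution A B C D P H L"
  then have sol: "null_solution A B C D P H L" unfolding maximal_null_solution_def by auto
  then obtain m where P: "P \<in> carrier_mat m n" unfolding null_solution_iff by auto
  obtain k Q where Q: "Q \<in> carrier_mat k n" "mat_kernel Q = C_star A B C D"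
    by (rule C_star_kernel)
  then obtain H' L' where "null_solution A B C D Q H' L'"
    using null_solution_of_C_star_kernel by blast
  then have "row_space Q \<subseteq> row_space P" using max unfolding maximal_null_solution_def by auto
  then have "mat_kernel P \<subseteq> C_star A B C D" using row_space_subset_iff[OF P Q(1)] Q(2) by auto
  then show "null_solution A B C D P H L \<and> mat_kernel P = C_star A B C D"
    using sol C_star_subset_kernel by blast
next
  assume P: "null_solution A B C D P H L \<and> mat_kernel P = C_star A B C D"
  then obtain m where Pm: "P \<in> carrier_mat m n" unfolding null_solution_iff by auto
  have "row_space Q \<subseteq> row_space P" if Q: "null_solution A B C D Q H' L'" for Q H' L'
  proof -
    from Q obtain k where "Q \<in> carrier_mat k n" unfolding null_solution_iff by auto
    then show ?thesis using C_star_subset_kernel[OF Q] P Pm row_space_subset_iff by blast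
  qed
  then show "maximal_null_solution A B C D P H L"
    using P unfolding maximal_null_solution_def by blast
qed

lemma V_left_eq_row_space:
  assumes "maximal_null_solution A B C D P H L"
  shows "V_left A B C D = row_space P"
  unfolding V_left_def
proof (rule the_equality)
  show "\<exists>P' H L. maximal_null_solution A B C D P' H L \<and> row_space P = row_space P'"
    using assms by blast
next
  fix V assume "\<exists>P H L. maximal_null_solution A B C D P H L \<and> V = row_space P"
  then show "V = row_space P"
    using assms unfolding maximal_null_solution_def by blast
qed

end

theorem theorem4p1:
  fixes F :: "complex \<Rightarrow> complex mat"
    and A B C D :: "complex mat"
    and n p q :: nat
  assumes "A \<in> carrier_mat n n" and "B \<in> carrier_mat n q"
    and "C \<in> carrier_mat p n" and "D \<in> carrier_mat p q"
    and "realization F A B C D"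
  shows "(\<forall>P H L. maximal_null_solution A B C D P H L \<longrightarrow> mat_kernel P = C_star A B C D) \<and>
         row_perp n (V_left A B C D) = C_star A B C D"
proof -
  interpret discrete_system A B C D n p q
    using assms by unfold_locales
  obtain m P where P: "P \<in> carrier_mat m n" "mat_kernel P = C_star A B C D"
    by (rule C_star_kernel)
  then obtain H L where "maximal_null_solution A B C D P H L"
    using null_solution_of_C_star_kernel maximal_null_solution_iff by blast
  then have "row_perp n (V_left A B C D) = C_star A B C D"
    using V_left_eq_row_space row_perp_row_space P by metis
  then show ?thesis using maximal_null_solution_iff by blast
qed

end
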